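(* (a) For each positive integer $n$ there is a countably infinite maximal antichain in $\langle\mathbb P(\mathbb B_n),\subset\rangle$. (b) Each infinite maximal antichain in $\langle\mathbb P(\mathbb B_\omega),\subset\rangle$ is uncountable.
   Context: For $1\le n\le\omega$, $\mathbb B_n=n\times\mathbb Q$ is ordered by $\langle i_1,q_1\rangle<\langle i_2,q_2\rangle$ iff $i_1=i_2$ and $q_1<_{\mathbb Q}q_2$. $\mathbb P(\mathbb B_n)$ is the set of subsets of $n\times\mathbb Q$ whose induced order is isomorphic to $\mathbb B_n$, ordered by inclusion. Two elements are compatible iff they have a common lower bound in $\mathbb P(\mathbb B_n)$; an antichain is a set of pairwise incompatible elements, maximal iff every element is compatible with some member. *)

theory Defs
  imports Complex_Main "HOL-Library.Countable_Set" "HOL-Library.Extended_Nat"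
begin

text \<open>The bound \<open>n\<close> is an extended natural number, with \<open>\<infinity>\<close> in the role of \<open>\<omega>\<close>.\<close>

definition BB :: "enat \<Rightarrow> (nat \<times> rat) set" where
  "BB n = {i. enat i < n} \<times> UNIV"

definition BB_less :: "nat \<times> rat \<Rightarrow> nat \<times> rat \<Rightarrow> bool" where
  "BB_less x y \<longleftrightarrow> fst x = fst y \<and> snd x < snd y"

definition order_isomorphic_on ::
  "('a \<Rightarrow> 'a \<Rightarrow> bool) \<Rightarrow> 'a set \<Rightarrow> ('b \<Rightarrow> 'b \<Rightarrow> bool) \<Rightarrow> 'b set \<Rightarrow> bool" where
  "order_isomorphic_on lt A lt' B \<longleftrightarrow>
     (\<exists>f. bij_betw f A B \<and> (\<forall>x\<in>A. \<forall>y\<in>A. lt x y \<longleftrightarrow> lt' (f x) (f y)))"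

definition copies :: "enat \<Rightarrow> (nat \<times> rat) set set" where
  "copies n = {A. A \<subseteq> BB n \<and> order_isomorphic_on BB_less A BB_less (BB n)}"

text \<open>The following notions are for a family \<open>P\<close> of sets ordered by inclusion.\<close>

definition compatible_in :: "'a set set \<Rightarrow> 'a set \<Rightarrow> 'a set \<Rightarrow> bool" where
  "compatible_in P A B \<longleftrightarrow> (\<exists>C\<in>P. C \<subseteq> A \<and> C \<subseteq> B)"

definition antichain_in :: "'a set set \<Rightarrow> 'a set set \<Rightarrow> bool" where
  "antichain_in P \<A> \<longleftrightarrow> \<A> \<subseteq> P \<and> pairwise (\<lambda>A B. \<not> compatible_in P A B) \<A>"

definition maximal_antichain_in :: "'a set set \<Rightarrow> 'a set set \<Rightarrow> bool" where
  "maximal_antichain_in P \<A> \<longleftrightarrow>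
     antichain_in P \<A> \<and> (\<forall>B\<in>P. \<exists>A\<in>\<A>. compatible_in P B A)"

end

theory Submission
  imports Defs
begin

text \<open>
  A subset of \<open>\<rat>\<close> contains a copy of \<open>\<rat>\<close> iff it contains a nonempty dense set without endpoints,
  and the subsets that contain no such set form an ideal. Hence two copies of \<open>BB n\<close>, \<open>n\<close> finite,
  are compatible iff their sections over each \<open>i < n\<close> meet in a set outside this ideal; for
  \<open>BB \<infinity>\<close> this has to happen for infinitely many \<open>i\<close>.

  (a) Keep every component except the first one full, and cut the first one into the countably many
  open intervals between consecutive odd integers.

  (b) Given pairwise incompatible \<open>A\<^sub>0, A\<^sub>1, \<dots>\<close>, pick \<open>i\<^sub>0 < i\<^sub>1 < \<dots>\<close> such that the section of
  \<open>A\<^sub>k\<close> over \<open>i\<^sub>k\<close> minus those of \<open>A\<^sub>j\<close>, \<open>j < k\<close>, contains a copy of \<open>\<rat>\<close>. The union of these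
  copies meets each \<open>A\<^sub>j\<close> in finitely many components only, so it is incompatible with all of them.
\<close>

section \<open>Dense linear orders without endpoints\<close>

definition dlo :: "'a::linorder set \<Rightarrow> bool" where
  "dlo D \<longleftrightarrow> D \<noteq> {} \<and> (\<forall>x\<in>D. \<exists>y\<in>D. y < x) \<and> (\<forall>x\<in>D. \<exists>y\<in>D. x < y) \<and>
     (\<forall>x\<in>D. \<forall>y\<in>D. x < y \<longrightarrow> (\<exists>z\<in>D. x < z \<and> z < y))"

lemma dlo_nonempty: "dlo D \<Longrightarrow> \<exists>x. x \<in> D"
  by (auto simp: dlo_def)

lemma dlo_lower: "dlo D \<Longrightarrow> x \<in> D \<Longrightarrow> \<exists>y\<in>D. y < x"
  by (auto simp: dlo_def)

lemma dlo_upper: "dlo D \<Longrightarrow> x \<in> D \<Longrightarrow> \<exists>y\<in>D. x < y"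
  by (auto simp: dlo_def)

lemma dlo_dense: "dlo D \<Longrightarrow> x \<in> D \<Longrightarrow> y \<in> D \<Longrightarrow> x < y \<Longrightarrow> \<exists>z\<in>D. x < z \<and> z < y"
  by (auto simp: dlo_def)

text \<open>It suffices to fit \<open>d\<close> between \<open>Max L\<close> and
  \<open>Min U\<close>; the four cases of which set is empty match the four clauses of
  \<open>dlo\<close>. This is the one-point extension step for the embedding below.\<close>

lemma dlo_interpolate:
  assumes D: "dlo D" and "finite L" "finite U" "L \<subseteq> D" "U \<subseteq> D"
    and less: "\<And>l u. l \<in> L \<Longrightarrow> u \<in> U \<Longrightarrow> l < u"
  shows "\<exists>d\<in>D. (\<forall>l\<in>L. l < d) \<and> (\<forall>u\<in>U. d < u)"
proof (cases "L = {}")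
  case True
  show ?thesis
  proof (cases "U = {}")
    case False
    then have "Min U \<in> D" using assms by (meson Min_in subsetD)
    then obtain d where "d \<in> D" "d < Min U" using dlo_lower[OF D] by blast
    then show ?thesis using True False \<open>finite U\<close> by auto
  qed (use True dlo_nonempty[OF D] in auto)
next
  case L: False
  then have mL: "Max L \<in> D" "Max L \<in> L" using assms by (meson Max_in subsetD)+
  have "\<exists>d\<in>D. Max L < d \<and> (\<forall>u\<in>U. d < u)"
  proof (cases "U = {}")
    case False
    then have mU: "Min U \<in> D" "Min U \<in> U" using assms by (meson Min_in subsetD)+
    obtain d where "d \<in> D" "Max L < d" "d < Min U" using dlo_dense[OF D] mL mU less by blast
    then show ?thesis using False \<open>finite U\<close> by auto
  qed (use mL dlo_upper[OF D] in auto)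
  then show ?thesis using L \<open>finite L\<close> by auto
qed

text \<open>The ``forth'' half of Cantor's back-and-forth argument.\<close>

lemma dlo_embeds_countable:
  fixes D :: "'b::linorder set"
  assumes D: "dlo D"
  shows "\<exists>h :: 'a::{linorder,countable} \<Rightarrow> 'b. range h \<subseteq> D \<and> strict_mono h"
proof -
  \<comment> \<open>\<open>P f x d\<close> says that \<open>d\<close> is an admissible value at
    \<open>x\<close>, given the values at points with smaller code. It consults \<open>f\<close>
    only at those points, so \<open>h\<close> can be chosen by recursion on
    \<open>to_nat\<close>.\<close>
  define P where "P f x d \<longleftrightarrow> d \<in> D \<and> (\<forall>y::'a. to_nat y < to_nat x \<longrightarrow>
      (y < x \<longrightarrow> f y < d) \<and> (x < y \<longrightarrow> d < f y))" for f :: "'a \<Rightarrow> 'b" and x d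
  have "\<exists>h. \<forall>x. P h x (h x)"
  proof (rule dependent_wf_choice[where R = "measure to_nat"])
    show "P f x d = P g x d" if "\<And>z. (z, x) \<in> measure to_nat \<Longrightarrow> f z = g z" for f g x d
      using that by (simp add: P_def)
    fix x :: 'a and f
    assume IH: "\<And>y. (y, x) \<in> measure to_nat \<Longrightarrow> P f y (f y)"
    define S where "S = {y::'a. to_nat y < to_nat x}"
    have "finite S" unfolding S_def
      using finite_vimageI[OF finite_lessThan[of "to_nat x"], of "to_nat :: 'a \<Rightarrow> nat"]
      by (simp add: vimage_def)
    moreover have inD: "f y \<in> D" if "y \<in> S" for y
      using IH[of y] that by (simp add: S_def P_def)
    \<comment> \<open>The two values were put in order when the point with the larger code was
      treated.\<close>
    moreover have "f y < f z" if "y \<in> S" "z \<in> S" "y < x" "x < z" for y z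
    proof -
      have "to_nat y \<noteq> to_nat z" "y < z" using that by auto
      then show ?thesis using IH[of y] IH[of z] that unfolding P_def S_def
        by (metis (lifting) in_measure linorder_neqE_nat mem_Collect_eq)
    qed
    ultimately obtain d where "d \<in> D" "\<forall>l\<in>f ` {y\<in>S. y < x}. l < d" "\<forall>u\<in>f ` {y\<in>S. x < y}. d < u"
      using dlo_interpolate[OF D, of "f ` {y\<in>S. y < x}" "f ` {y\<in>S. x < y}"] by auto
    then show "\<exists>d. P f x d" by (auto simp: P_def S_def)
  qed auto
  then obtain h where h: "\<And>x. P h x (h x)" by blast
  have "h x < h y" if "x < y" for x y
  proof -
    have "to_nat x \<noteq> to_nat y" using that by auto
    then show ?thesis using h[of x] h[of y] that unfolding P_def
      by (metis linorder_neqE_nat)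
  qed
  moreover have "range h \<subseteq> D" using h by (auto simp: P_def)
  ultimately show ?thesis by (auto simp: strict_mono_def)
qed

lemma dlo_interval:
  assumes "dlo D" "u \<in> D" "v \<in> D" "u < v"
  shows "dlo (D \<inter> {u<..<v})"
proof -
  note dense = dlo_dense[OF assms(1)]
  show ?thesis unfolding dlo_def
  proof (intro conjI ballI impI)
    show "D \<inter> {u<..<v} \<noteq> {}" using dense[OF assms(2-4)] by auto
  next
    fix x assume "x \<in> D \<inter> {u<..<v}"
    then show "\<exists>y\<in>D \<inter> {u<..<v}. y < x" using dense[of u x] assms by force
  next
    fix x assume "x \<in> D \<inter> {u<..<v}"
    then show "\<exists>y\<in>D \<inter> {u<..<v}. x < y" using dense[of x v] assms by force
  next
    fix x y assume "x \<in> D \<inter> {u<..<v}" "y \<in> D \<inter> {u<..<v}" "x < y"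
    then show "\<exists>z\<in>D \<inter> {u<..<v}. x < z \<and> z < y" using dense[of x y] assms by force
  qed
qed

text \<open>Either some open interval of \<open>D\<close> misses \<open>Z\<close> and lies in
  \<open>D - Z\<close>, or \<open>Z\<close> meets all of them and \<open>D \<inter> Z\<close> is
  itself dense without endpoints. This is the ideal property.\<close>

lemma dlo_partition:
  assumes D: "dlo D"
  shows "(\<exists>E. dlo E \<and> E \<subseteq> D \<inter> Z) \<or> (\<exists>E. dlo E \<and> E \<subseteq> D - Z)"
proof (cases "\<exists>u\<in>D. \<exists>v\<in>D. u < v \<and> D \<inter> {u<..<v} \<inter> Z = {}")
  case True
  then obtain u v where "u \<in> D" "v \<in> D" "u < v" "D \<inter> {u<..<v} \<inter> Z = {}" by blast
  then show ?thesis using dlo_interval[OF D] by blast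
next
  case False
  then have Z: "\<exists>z\<in>D \<inter> Z. u < z \<and> z < v" if "u \<in> D" "v \<in> D" "u < v" for u v
    using that by force
  have "dlo (D \<inter> Z)" unfolding dlo_def
  proof (intro conjI ballI impI)
    obtain x where "x \<in> D" using dlo_nonempty[OF D] by blast
    then show "D \<inter> Z \<noteq> {}" using dlo_upper[OF D, of x] Z[of x] by auto
  next
    fix x assume "x \<in> D \<inter> Z"
    then show "\<exists>y\<in>D \<inter> Z. y < x" using dlo_lower[OF D, of x] Z[of _ x] by blast
  next
    fix x assume "x \<in> D \<inter> Z"
    then show "\<exists>y\<in>D \<inter> Z. x < y" using dlo_upper[OF D, of x] Z[of x] by blast
  next
    fix x y assume "x \<in> D \<inter> Z" "y \<in> D \<inter> Z" "x < y"
    then show "\<exists>z\<in>D \<inter> Z. x < z \<and> z < y" using Z[of x y] by blast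
  qed
  then show ?thesis by blast
qed

text \<open>Remove the sets \<open>Z j\<close> one at a time with \<open>dlo_partition\<close>. The
  hypothesis excludes the alternative inside \<open>Z j\<close>, and it passes to subsets of
  \<open>D\<close>.\<close>

lemma dlo_avoid_finite:
  assumes "finite J" "dlo D" "\<And>j E. j \<in> J \<Longrightarrow> dlo E \<Longrightarrow> \<not> E \<subseteq> D \<inter> Z j"
  shows "\<exists>E. dlo E \<and> E \<subseteq> D \<and> (\<forall>j\<in>J. E \<inter> Z j = {})"
  using assms
proof (induction J arbitrary: D rule: finite_induct)
  case (insert j J)
  then obtain D' where D': "dlo D'" "D' \<subseteq> D - Z j" using dlo_partition[of D "Z j"] by blast
  have "\<not> E \<subseteq> D' \<inter> Z i" if "i \<in> J" "dlo E" for i E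
    using insert.prems(2)[of i E] that D' by blast
  then obtain E where "dlo E" "E \<subseteq> D'" "\<forall>j\<in>J. E \<inter> Z j = {}"
    using insert.IH[OF D'(1)] by blast
  then show ?case using D' by (intro exI[of _ E]) auto
qed auto

section \<open>Sections and components of copies\<close>

text \<open>Components are determined by comparability, so the isomorphism carries the section over
  \<open>i\<close> onto a full component of \<open>BB n\<close>, whose density and lack of endpoints
  pull back.\<close>

lemma dlo_copies_section:
  assumes A: "A \<in> copies n" and i: "i \<in> Domain A"
  shows "dlo (A `` {i})"
proof -
  obtain f where f: "bij_betw f A (BB n)"
    and less: "\<And>x y. x \<in> A \<Longrightarrow> y \<in> A \<Longrightarrow> BB_less x y \<longleftrightarrow> BB_less (f x) (f y)"
    using A by (auto simp: copies_def order_isomorphic_on_def)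
  have mem: "f x \<in> BB n" if "x \<in> A" for x using f that by (auto simp: bij_betw_def)
  have surj: "\<exists>x\<in>A. f x = y" if "y \<in> BB n" for y
    using f that by (metis bij_betw_imp_surj_on imageE)
  \<comment> \<open>The point with second coordinate \<open>t\<close> is comparable with
    \<open>f (i, q)\<close>, so its preimage is comparable with \<open>(i, q)\<close> and lies over
    the same \<open>i\<close>.\<close>
  have *: "\<exists>r. (i, r) \<in> A \<and> f (i, r) = (fst (f (i, q)), t)"
    if q: "(i, q) \<in> A" and t: "t \<noteq> snd (f (i, q))" for q t
  proof -
    obtain x where x: "x \<in> A" "f x = (fst (f (i, q)), t)"
      using surj[of "(fst (f (i, q)), t)"] mem[OF q] by (auto simp: BB_def)
    then have "BB_less (f x) (f (i, q)) \<or> BB_less (f (i, q)) (f x)"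
      using t by (auto simp: BB_less_def)
    then have "fst x = i" using less x q by (metis BB_less_def fst_conv)
    then show ?thesis using x by (metis prod.collapse)
  qed
  show ?thesis unfolding dlo_def
  proof (intro conjI ballI impI)
    show "A `` {i} \<noteq> {}" using i by auto
  next
    fix q assume q: "q \<in> A `` {i}"
    then obtain r where "(i, r) \<in> A" "f (i, r) = (fst (f (i, q)), snd (f (i, q)) - 1)"
      using *[of q "snd (f (i, q)) - 1"] by auto
    then show "\<exists>r\<in>A `` {i}. r < q" using less[of "(i, r)" "(i, q)"] q
      by (intro bexI[of _ r]) (auto simp: BB_less_def)
  next
    fix q assume q: "q \<in> A `` {i}"
    then obtain r where "(i, r) \<in> A" "f (i, r) = (fst (f (i, q)), snd (f (i, q)) + 1)"
      using *[of q "snd (f (i, q)) + 1"] by auto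
    then show "\<exists>r\<in>A `` {i}. q < r" using less[of "(i, q)" "(i, r)"] q
      by (intro bexI[of _ r]) (auto simp: BB_less_def)
  next
    fix p q assume pq: "p \<in> A `` {i}" "q \<in> A `` {i}" "p < q"
    then have "BB_less (f (i, p)) (f (i, q))" using less[of "(i, p)" "(i, q)"]
      by (auto simp: BB_less_def)
    then obtain t where t: "fst (f (i, p)) = fst (f (i, q))" "snd (f (i, p)) < t" "t < snd (f (i, q))"
      using dense by (auto simp: BB_less_def)
    then obtain r where "(i, r) \<in> A" "f (i, r) = (fst (f (i, q)), t)"
      using *[of q t] pq by auto
    then show "\<exists>r\<in>A `` {i}. p < r \<and> r < q"
      using less[of "(i, p)" "(i, r)"] less[of "(i, r)" "(i, q)"] pq t
      by (intro bexI[of _ r]) (auto simp: BB_less_def)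
  qed
qed

text \<open>Preimages of the points \<open>(i, 0)\<close> are pairwise incomparable, whereas
  distinct points over one index are comparable.\<close>

lemma copies_Domain_inj:
  assumes A: "A \<in> copies n"
  shows "\<exists>g. inj_on g {i. enat i < n} \<and> g ` {i. enat i < n} \<subseteq> Domain A"
proof -
  obtain f where f: "bij_betw f A (BB n)"
    and less: "\<And>x y. x \<in> A \<Longrightarrow> y \<in> A \<Longrightarrow> BB_less x y \<longleftrightarrow> BB_less (f x) (f y)"
    using A by (auto simp: copies_def order_isomorphic_on_def)
  have "\<exists>x\<in>A. f x = (i, 0)" if "enat i < n" for i
  proof -
    have "(i, 0) \<in> f ` A" using f that by (simp add: bij_betw_def BB_def)
    then show ?thesis by force
  qed
  then obtain a where a: "\<And>i. enat i < n \<Longrightarrow> a i \<in> A" "\<And>i. enat i < n \<Longrightarrow> f (a i) = (i, 0)"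
    by metis
  have "i = j" if ij: "enat i < n" "enat j < n" "fst (a i) = fst (a j)" for i j
  proof (rule ccontr)
    assume "i \<noteq> j"
    then have "a i \<noteq> a j" using a ij by (metis fst_conv)
    then have "BB_less (a i) (a j) \<or> BB_less (a j) (a i)"
      using ij by (auto simp: BB_less_def prod_eq_iff)
    then show False
      using less[of "a i" "a j"] less[of "a j" "a i"] a ij \<open>i \<noteq> j\<close> by (auto simp: BB_less_def)
  qed
  then have "inj_on (\<lambda>i. fst (a i)) {i. enat i < n}" by (auto simp: inj_on_def)
  moreover have "(\<lambda>i. fst (a i)) ` {i. enat i < n} \<subseteq> Domain A"
    using a by (force simp: Domain_fst)
  ultimately show ?thesis by blast
qed

lemma copies_Domain_subset: "A \<in> copies n \<Longrightarrow> Domain A \<subseteq> {i. enat i < n}"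
  by (auto simp: copies_def BB_def)

text \<open>An injection of \<open>{..<n}\<close> into itself is onto. Hence every copy has points
  over 0 once \<open>n \<ge> 1\<close>, which makes the strips below incompatible.\<close>

lemma copies_Domain_finite:
  assumes A: "A \<in> copies (enat n)"
  shows "Domain A = {..<n}"
proof -
  have sub: "Domain A \<subseteq> {..<n}" using copies_Domain_subset[OF A] by auto
  obtain g where "inj_on g {..<n}" "g ` {..<n} \<subseteq> Domain A"
    using copies_Domain_inj[OF A] by (auto simp: lessThan_def)
  moreover from this have "g ` {..<n} = {..<n}" using sub by (intro endo_inj_surj) auto
  ultimately show ?thesis using sub by auto
qed

lemma copies_Domain_infinite:
  assumes A: "A \<in> copies \<infinity>"
  shows "infinite (Domain A)"
proof -
  obtain g :: "nat \<Rightarrow> nat" where "inj g" "range g \<subseteq> Domain A"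
    using copies_Domain_inj[OF A] by auto
  then show ?thesis by (meson finite_imageD finite_subset infinite_UNIV_nat)
qed

section \<open>Assembling copies from dense pieces\<close>

lemma embedding_image_in_copies:
  assumes inj: "inj_on g {i. enat i < n}" and g: "g ` {i. enat i < n} \<subseteq> {i. enat i < n}"
    and h: "\<And>i. enat i < n \<Longrightarrow> strict_mono (h i)"
  shows "(\<lambda>(i, q). (g i, h i q)) ` BB n \<in> copies n"
proof -
  let ?f = "\<lambda>(i, q). (g i, h i q)"
  have f: "inj_on ?f (BB n)"
    using inj strict_mono_eq[OF h] by (auto simp: inj_on_def BB_def)
  have less: "BB_less (?f x) (?f y) \<longleftrightarrow> BB_less x y" if "x \<in> BB n" "y \<in> BB n" for x y
    using that inj strict_mono_less[OF h] by (auto simp: BB_less_def BB_def inj_on_eq_iff)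
  have "bij_betw (inv_into (BB n) ?f) (?f ` BB n) (BB n)"
    using f by (simp add: bij_betw_inv_into inj_on_imp_bij_betw)
  moreover have "BB_less x y \<longleftrightarrow> BB_less (inv_into (BB n) ?f x) (inv_into (BB n) ?f y)"
    if "x \<in> ?f ` BB n" "y \<in> ?f ` BB n" for x y
    using less inv_into_into[OF that(1)] inv_into_into[OF that(2)]
    by (metis (no_types, lifting) f_inv_into_f that)
  ultimately have "order_isomorphic_on BB_less (?f ` BB n) BB_less (BB n)"
    unfolding order_isomorphic_on_def by blast
  then show ?thesis using g by (auto simp: copies_def BB_def)
qed

text \<open>Each \<open>D i\<close> receives an embedded copy of the rationals, placed in component
  \<open>g i\<close>. Here \<open>g\<close> is the identity in (a) and a strictly increasing
  sequence of components in (b).\<close>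

lemma ex_copy_in_dlos:
  assumes inj: "inj_on g {i. enat i < n}" and g: "g ` {i. enat i < n} \<subseteq> {i. enat i < n}"
    and D: "\<And>i. enat i < n \<Longrightarrow> dlo (D i)"
  shows "\<exists>C\<in>copies n. \<forall>x\<in>C. \<exists>i. enat i < n \<and> fst x = g i \<and> snd x \<in> D i"
proof -
  have "\<exists>h::rat \<Rightarrow> rat. range h \<subseteq> D i \<and> strict_mono h" if "enat i < n" for i
    using dlo_embeds_countable[OF D[OF that]] .
  then obtain h :: "nat \<Rightarrow> rat \<Rightarrow> rat"
    where h: "\<And>i. enat i < n \<Longrightarrow> range (h i) \<subseteq> D i" "\<And>i. enat i < n \<Longrightarrow> strict_mono (h i)"
    by metis
  show ?thesis
    by (rule bexI[OF _ embedding_image_in_copies[OF inj g h(2)]])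
      (use h(1) in \<open>auto simp: BB_def image_subset_iff\<close>)
qed

section \<open>Finite case: a countably infinite maximal antichain\<close>

text \<open>This map takes an ordered field onto its interval from -1 to 1, so it gives an
  isomorphism that stays within the rationals.\<close>

lemma strict_mono_squash: "strict_mono (\<lambda>x::'a::linordered_field. x / (1 + \<bar>x\<bar>))"
proof (rule strict_monoI)
  fix x y :: 'a assume "x < y"
  have "x * (1 + \<bar>y\<bar>) < y * (1 + \<bar>x\<bar>)"
  proof -
    \<comment> \<open>Equality holds unless \<open>x\<close> is negative and \<open>y\<close> is
      not; then zero separates the two sides.\<close>
    have "x * \<bar>y\<bar> \<le> y * \<bar>x\<bar>"
    proof (cases "x < 0 \<and> 0 \<le> y")
      case True
      then have "x * \<bar>y\<bar> \<le> 0" "0 \<le> y * \<bar>x\<bar>"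
        by (auto intro: mult_nonpos_nonneg mult_nonneg_nonpos mult_nonneg_nonneg)
      then show ?thesis by simp
    qed (use \<open>x < y\<close> in \<open>auto simp: abs_if\<close>)
    then show ?thesis using \<open>x < y\<close> by (simp add: algebra_simps)
  qed
  moreover have "0 < 1 + \<bar>x\<bar>" "0 < 1 + \<bar>y\<bar>" by (simp_all add: add_pos_nonneg)
  ultimately show "x / (1 + \<bar>x\<bar>) < y / (1 + \<bar>y\<bar>)"
    by (simp add: divide_less_eq less_divide_eq mult.commute)
qed

lemma range_squash: "range (\<lambda>x::'a::linordered_field. x / (1 + \<bar>x\<bar>)) = {-1<..<1}"
proof (intro equalityI subsetI)
  fix y :: 'a assume "y \<in> range (\<lambda>x::'a. x / (1 + \<bar>x\<bar>))"
  then obtain x where x: "y = x / (1 + \<bar>x\<bar>)" by auto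
  have "0 < 1 + \<bar>x\<bar>" by (simp add: add_pos_nonneg)
  then show "y \<in> {-1<..<1}" by (auto simp: x divide_less_eq less_divide_eq abs_if)
next
  fix y :: 'a assume y: "y \<in> {-1<..<1}"
  then have "0 < 1 - \<bar>y\<bar>" by (auto simp: abs_if)
  then have "y = (y / (1 - \<bar>y\<bar>)) / (1 + \<bar>y / (1 - \<bar>y\<bar>)\<bar>)"
    by (simp add: field_simps)
  then show "y \<in> range (\<lambda>x::'a. x / (1 + \<bar>x\<bar>))" by blast
qed

text \<open>Radius one about \<open>2 * k\<close> makes the interval a translate of the range
  computed above. The odd integers in component 0 lie in no strip, which costs nothing for
  maximality.\<close>

definition strip :: "nat \<Rightarrow> int \<Rightarrow> (nat \<times> rat) set" where
  "strip n k = {(i, q). i < n \<and> (i = 0 \<longrightarrow> 2 * of_int k - 1 < q \<and> q < 2 * of_int k + 1)}"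

lemma strip_in_copies: "strip n k \<in> copies (enat n)"
proof -
  define h :: "nat \<Rightarrow> rat \<Rightarrow> rat" where
    "h i q = (if i = 0 then 2 * of_int k + q / (1 + \<bar>q\<bar>) else q)" for i q
  have "strict_mono (h i)" for i
    using strict_mono_squash[where 'a = rat] by (auto simp: h_def strict_mono_def)
  then have *: "(\<lambda>(i, q). (i, h i q)) ` BB (enat n) \<in> copies (enat n)"
    using embedding_image_in_copies[of id "enat n" h] by simp
  have "range (h 0) = {2 * of_int k - 1<..<2 * of_int k + 1}"
  proof -
    have "range (h 0) = (\<lambda>q. 2 * of_int k + q) ` range (\<lambda>q. q / (1 + \<bar>q\<bar>))"
      by (auto simp: h_def)
    also have "\<dots> = {2 * of_int k - 1<..<2 * of_int k + 1}"
      unfolding range_squash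
    proof (intro equalityI subsetI)
      fix q :: rat assume "q \<in> {2 * of_int k - 1<..<2 * of_int k + 1}"
      then have "q - 2 * of_int k \<in> {-1<..<1}" by auto
      then show "q \<in> (+) (2 * of_int k) ` {-1<..<1}"
        by (intro image_eqI[of _ _ "q - 2 * of_int k"]) auto
    qed auto
    finally show ?thesis .
  qed
  then have "range (h i) = (if i = 0 then {2 * of_int k - 1<..<2 * of_int k + 1} else UNIV)" for i
    by (auto simp: h_def)
  moreover have "(\<lambda>(i, q). (i, h i q)) ` BB (enat n) = Sigma {..<n} (\<lambda>i. range (h i))"
    by (auto simp: BB_def)
  moreover have "strip n k = Sigma {..<n} (\<lambda>i. if i = 0
      then {2 * of_int k - 1<..<2 * of_int k + 1} else UNIV)"
    by (auto simp: strip_def)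
  ultimately have "(\<lambda>(i, q). (i, h i q)) ` BB (enat n) = strip n k"
    by simp
  then show ?thesis using * by simp
qed

text \<open>A common lower bound has a point over 0, and intervals of radius one about distinct even
  integers are disjoint.\<close>

lemma strip_incompatible:
  assumes "n \<ge> 1" "compatible_in (copies (enat n)) (strip n k) (strip n l)"
  shows "k = l"
proof -
  obtain C where C: "C \<in> copies (enat n)" "C \<subseteq> strip n k" "C \<subseteq> strip n l"
    using assms by (auto simp: compatible_in_def)
  then have "0 \<in> Domain C" using copies_Domain_finite assms by auto
  then obtain q where "(0, q) \<in> C" by auto
  then have "(0, q) \<in> strip n k" "(0, q) \<in> strip n l" using C by auto
  then have "(of_int (2 * k - 1) :: rat) < of_int (2 * l + 1)"
      "(of_int (2 * l - 1) :: rat) < of_int (2 * k + 1)"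
    by (auto simp: strip_def)
  then show ?thesis unfolding of_int_less_iff by simp
qed

text \<open>Over 0, a bounded piece of the section of \<open>B\<close> meets only finitely many
  intervals, so one of them catches a dense piece. Over the other indices the strip is full.\<close>

lemma strip_compatible:
  assumes n: "n \<ge> 1" and B: "B \<in> copies (enat n)"
  shows "\<exists>k. compatible_in (copies (enat n)) B (strip n k)"
proof -
  have dom: "Domain B = {..<n}" using copies_Domain_finite[OF B] .
  then have D: "dlo (B `` {i})" if "i < n" for i using dlo_copies_section[OF B] that by auto
  define X where "X = B `` {0}"
  have X: "dlo X" using D n by (simp add: X_def)
  then obtain x y where xy: "x \<in> X" "y \<in> X" "x < y" using dlo_nonempty dlo_upper by blast
  \<comment> \<open>\<open>fl q = k\<close> means \<open>2 * k - 1 \<le> q < 2 * k + 1\<close>;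
    these half-open intervals cover the rationals.\<close>
  define fl :: "rat \<Rightarrow> int" where "fl q = \<lfloor>(q + 1) / 2\<rfloor>" for q
  \<comment> \<open>Otherwise \<open>dlo_avoid_finite\<close> yields a nonempty set between
    \<open>x\<close> and \<open>y\<close> that avoids every value \<open>fl\<close> can take
    there.\<close>
  have "\<exists>k\<in>{fl x..fl y}. \<exists>E. dlo E \<and> E \<subseteq> (X \<inter> {x<..<y}) \<inter> {q. fl q = k}"
  proof (rule ccontr)
    assume "\<not> ?thesis"
    then obtain E where E: "dlo E" "E \<subseteq> X \<inter> {x<..<y}" "\<forall>k\<in>{fl x..fl y}. E \<inter> {q. fl q = k} = {}"
      using dlo_avoid_finite[OF _ dlo_interval[OF X xy], of "{fl x..fl y}" "\<lambda>k. {q. fl q = k}"]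
      by blast
    then obtain q where "q \<in> E" using dlo_nonempty by blast
    moreover from this have "fl q \<in> {fl x..fl y}"
      using E(2) by (auto simp: fl_def intro!: floor_mono divide_right_mono)
    ultimately show False using E by blast
  qed
  then obtain k E where E: "dlo E" "E \<subseteq> X" "E \<subseteq> {q. fl q = k}" by blast
  \<comment> \<open>The left endpoint of the half-open interval is excluded because \<open>E\<close> has no least element.\<close>
  have E': "2 * of_int k - 1 < q \<and> q < 2 * of_int k + 1" if q: "q \<in> E" for q
  proof -
    obtain p where p: "p \<in> E" "p < q" using dlo_lower[OF E(1) q] by blast
    then have "fl p = k" "fl q = k" using E q by auto
    then have "of_int k \<le> (p + 1) / 2" "(q + 1) / 2 < of_int k + 1"
      unfolding fl_def by linarith+
    then show ?thesis using p by (simp add: field_simps)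
  qed
  obtain C where C: "C \<in> copies (enat n)"
    "\<forall>x\<in>C. fst x < n \<and> snd x \<in> (if fst x = 0 then E else B `` {fst x})"
  proof -
    have "dlo (if i = 0 then E else B `` {i})" if "enat i < enat n" for i
      using D E(1) that by simp
    from ex_copy_in_dlos[of id "enat n" "\<lambda>i. if i = 0 then E else B `` {i}", OF _ _ this]
    obtain C where "C \<in> copies (enat n)"
      "\<forall>x\<in>C. fst x < n \<and> snd x \<in> (if fst x = 0 then E else B `` {fst x})" by auto
    then show thesis by (rule that)
  qed
  have "C \<subseteq> B" "C \<subseteq> strip n k"
    using C(2) E(2) E' by (fastforce simp: strip_def X_def split: if_splits)+
  then show ?thesis using C(1) by (auto simp: compatible_in_def)
qed

lemma ex_countable_maximal_antichain:
  assumes n: "n \<ge> 1"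
  shows "\<exists>\<A>. maximal_antichain_in (copies (enat n)) \<A> \<and> countable \<A> \<and> infinite \<A>"
proof (intro exI conjI)
  have "inj (strip n)"
  proof (rule injI)
    fix k l assume "strip n k = strip n l"
    then have "compatible_in (copies (enat n)) (strip n k) (strip n l)"
      using strip_in_copies[of n k] by (auto simp: compatible_in_def)
    then show "k = l" using strip_incompatible[OF n] by blast
  qed
  then show "infinite (range (strip n))" using finite_imageD infinite_UNIV_int by blast
  show "countable (range (strip n))" by simp
  show "maximal_antichain_in (copies (enat n)) (range (strip n))"
    unfolding maximal_antichain_in_def antichain_in_def pairwise_def
    using strip_in_copies strip_incompatible[OF n] strip_compatible[OF n] by blast
qed

section \<open>Infinite case: diagonalizing against a countable antichain\<close>

text \<open>Dense pieces over infinitely many such \<open>i\<close> would assemble into a copy of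
  \<open>BB \<infinity>\<close> below both \<open>A\<close> and \<open>B\<close>.\<close>

lemma incompatible_common_dlo_finite:
  assumes "\<not> compatible_in (copies \<infinity>) A B"
  shows "finite {i. \<exists>E. dlo E \<and> E \<subseteq> A `` {i} \<inter> B `` {i}}" (is "finite ?S")
proof (rule ccontr)
  assume "infinite ?S"
  then have g: "inj (enumerate ?S)" "\<And>k. enumerate ?S k \<in> ?S"
    using strict_mono_enumerate strict_mono_imp_inj_on enumerate_in_set by blast+
  then have "\<forall>k. \<exists>E. dlo E \<and> E \<subseteq> A `` {enumerate ?S k} \<inter> B `` {enumerate ?S k}" by blast
  from choice[OF this] obtain E where E: "\<And>k. dlo (E k)"
      "\<And>k. E k \<subseteq> A `` {enumerate ?S k} \<inter> B `` {enumerate ?S k}"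
    by blast
  obtain C where C: "C \<in> copies \<infinity>" "\<forall>x\<in>C. \<exists>k. fst x = enumerate ?S k \<and> snd x \<in> E k"
    using ex_copy_in_dlos[of "enumerate ?S" \<infinity> E] g E(1) by auto
  have "C \<subseteq> A \<inter> B"
  proof
    fix x assume "x \<in> C"
    then obtain k where "fst x = enumerate ?S k" "snd x \<in> E k" using C by blast
    then show "x \<in> A \<inter> B" using E(2)[of k] by (cases x) auto
  qed
  then show False using assms C(1) by (auto simp: compatible_in_def)
qed

lemma sequence_not_maximal:
  assumes A: "\<And>k. A k \<in> copies \<infinity>"
    and incomp: "\<And>j k. j < k \<Longrightarrow> \<not> compatible_in (copies \<infinity>) (A k) (A j)"
  shows "\<exists>B\<in>copies \<infinity>. \<forall>j::nat. \<not> compatible_in (copies \<infinity>) B (A j)"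
proof -
  define P where "P k i \<longleftrightarrow> (\<exists>E. dlo E \<and> E \<subseteq> A k `` {i} \<and> (\<forall>j<k. E \<inter> A j `` {i} = {}))" for k i
  have step: "\<exists>i>m. P k i" for k m
  proof -
    define S where "S j = {i. \<exists>E. dlo E \<and> E \<subseteq> A k `` {i} \<inter> A j `` {i}}" for j
    \<comment> \<open>To be avoided are the components where \<open>A k\<close> shares a dense piece
      with an earlier set, and those up to \<open>m\<close>, so that the chosen indices increase.
      The infinite \<open>Domain (A k)\<close> leaves some \<open>i\<close>.\<close>
    have "finite ((\<Union>j<k. S j) \<union> {..m})"
      using incompatible_common_dlo_finite[OF incomp] by (auto simp: S_def)
    then obtain i where i: "i \<in> Domain (A k)" "i \<notin> (\<Union>j<k. S j) \<union> {..m}"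
      using copies_Domain_infinite[OF A[of k]] by (meson finite_subset subsetI)
    have "\<not> E \<subseteq> A k `` {i} \<inter> (A j `` {i})" if "j \<in> {..<k}" "dlo E" for j E
      using i(2) that by (auto simp: S_def)
    then have "P k i"
      using dlo_avoid_finite[of "{..<k}" "A k `` {i}" "\<lambda>j. A j `` {i}"]
        dlo_copies_section[OF A i(1)] by (simp add: P_def Ball_def)
    moreover have "i > m" using i by auto
    ultimately show ?thesis by blast
  qed
  have "\<exists>g. \<forall>k. P k (g k) \<and> g k < g (Suc k)"
    by (rule dependent_nat_choice) (use step in blast)+
  then obtain g where g: "\<And>k. P k (g k)" "strict_mono g"
    by (auto simp: strict_mono_Suc_iff)
  have "\<forall>k. \<exists>E. dlo E \<and> (\<forall>j<k. E \<inter> A j `` {g k} = {})"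
    using g(1) unfolding P_def by blast
  from choice[OF this] obtain E where E: "\<And>k. dlo (E k)"
      "\<And>j k. j < k \<Longrightarrow> E k \<inter> A j `` {g k} = {}"
    by blast
  obtain B where B: "B \<in> copies \<infinity>" "\<forall>x\<in>B. \<exists>k. fst x = g k \<and> snd x \<in> E k"
    using ex_copy_in_dlos[of g \<infinity> E] strict_mono_imp_inj_on[OF g(2)] E(1) by auto
  have "\<not> compatible_in (copies \<infinity>) B (A j)" for j
  proof
    assume "compatible_in (copies \<infinity>) B (A j)"
    then obtain C where C: "C \<in> copies \<infinity>" "C \<subseteq> B" "C \<subseteq> A j" by (auto simp: compatible_in_def)
    \<comment> \<open>For \<open>k > j\<close> the piece \<open>E k\<close> misses
      \<open>A j\<close> over \<open>g k\<close>. The piece \<open>E j\<close> may still meet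
      \<open>A j\<close>, hence the inclusive bound.\<close>
    have "Domain C \<subseteq> g ` {..j}"
    proof
      fix i assume "i \<in> Domain C"
      then obtain q where q: "(i, q) \<in> C" by auto
      then obtain k where k: "i = g k" "q \<in> E k" using B C by fastforce
      then have "\<not> j < k" using E(2)[of j k] q C by auto
      then show "i \<in> g ` {..j}" using k by auto
    qed
    then show False using copies_Domain_infinite[OF C(1)] by (meson finite_atMost finite_imageI finite_subset)
  qed
  then show ?thesis using B(1) by blast
qed

theorem theorem5p3:
  shows "(\<forall>n::nat. n \<ge> 1 \<longrightarrow>
            (\<exists>\<A>. maximal_antichain_in (copies (enat n)) \<A> \<and> countable \<A> \<and> infinite \<A>)) \<and>
         (\<forall>\<A>. maximal_antichain_in (copies \<infinity>) \<A> \<and> infinite \<A> \<longrightarrow> uncountable \<A>)"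
proof (intro conjI allI impI notI)
  show "\<exists>\<A>. maximal_antichain_in (copies (enat n)) \<A> \<and> countable \<A> \<and> infinite \<A>"
    if "n \<ge> 1" for n using ex_countable_maximal_antichain[OF that] .
next
  fix \<A> :: "(nat \<times> rat) set set"
  assume \<A>: "maximal_antichain_in (copies \<infinity>) \<A> \<and> infinite \<A>" and "countable \<A>"
  \<comment> \<open>An enumeration without repetition makes \<open>?A k\<close> and
    \<open>?A j\<close> distinct, hence incompatible, for \<open>j < k\<close>.\<close>
  then have bij: "bij_betw (from_nat_into \<A>) UNIV \<A>" by (simp add: bij_betw_from_nat_into)
  let ?A = "from_nat_into \<A>"
  have mem: "?A k \<in> \<A>" for k using bij by (auto simp: bij_betw_def)
  have "?A k \<noteq> ?A j" if "j < k" for j k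
    using bij that by (auto simp: bij_betw_def inj_eq)
  then have "\<exists>B\<in>copies \<infinity>. \<forall>j. \<not> compatible_in (copies \<infinity>) B (?A j)"
    using \<A> mem by (intro sequence_not_maximal)
      (auto simp: maximal_antichain_in_def antichain_in_def pairwise_def)
  then obtain B where B: "B \<in> copies \<infinity>" "\<And>j. \<not> compatible_in (copies \<infinity>) B (?A j)" by blast
  then obtain X where "X \<in> \<A>" "compatible_in (copies \<infinity>) B X"
    using \<A> by (auto simp: maximal_antichain_in_def)
  moreover have "\<A> = range ?A" using bij by (simp add: bij_betw_def)
  ultimately show False using B(2) by (metis rangeE)
qed

end
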